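(* Let $F,K,X,Y\in\mathcal{B}_A(\mathcal{H})$, $\mu\in[0,1]$, $\alpha\in\mathbb{C}\setminus\{0\}$ and $\beta\ge 0$. Then $$\begin{aligned}\omega_{\mathbb{A}}^4\left(\begin{bmatrix} F& X\\ Y& K\end{bmatrix}\right)\le\ & (2+2\chi_1+2\chi_3)\max\left\{\|(F^{\sharp_A}F)^{2}+(XX^{\sharp_A})^2\|_A,\ \|(K^{\sharp_A}K)^{2}+(YY^{\sharp_A})^2\|_A\right\}\\ &+(2\chi_2+2\mu\chi_4)\max\left\{\|F^{\sharp_A}F+XX^{\sharp_A}\|_A,\ \|K^{\sharp_A}K+YY^{\sharp_A}\|_A\right\}\omega_{\mathbb{A}}\left(\begin{bmatrix} 0& XK\\ YF& 0\end{bmatrix}\right)\\ &+(4+4(1-\mu)\chi_4)\,\omega_{\mathbb{A}}^2\left(\begin{bmatrix} 0& XK\\ YF& 0\end{bmatrix}\right),\end{aligned}$$ where $\chi_1=\frac{\beta+(\beta+1)\max\{1,|\alpha-1|^2\}}{|\alpha|^2(\beta+1)}$, $\chi_2=\frac{1+2(\beta+1)\max\{1,|\alpha-1|\}}{|\alpha|^2(\beta+1)}$, $\chi_3=\frac{2\beta+2(\beta+1)\max\{1,|\alpha-1|^2\}}{|\alpha|^2(\beta+1)}$ and $\chi_4=\frac{2}{|\alpha|^2(\beta+1)}$.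
   Context: $\mathcal{H}$ is a complex Hilbert space, $\mathcal{B}(\mathcal{H})$ the bounded linear operators on it, and $A\in\mathcal{B}(\mathcal{H})$ is a fixed positive (semidefinite) operator. Put $\langle x,y\rangle_A=\langle Ax,y\rangle$ and $\|x\|_A=\langle x,x\rangle_A^{1/2}$. $\mathcal{B}_A(\mathcal{H})$ is the set of $T\in\mathcal{B}(\mathcal{H})$ for which there is $S\in\mathcal{B}(\mathcal{H})$ with $AS=T^*A$; for such $T$, $T^{\sharp_A}=A^\dagger T^*A$ ($A^\dagger$ the Moore-Penrose inverse), i.e. the unique bounded solution $S$ of $AS=T^*A$ with range in $\overline{\mathrm{ran}(A)}$. The $A$-operator seminorm is $\|T\|_A=\sup\{\|Tx\|_A/\|x\|_A : x\in\overline{\mathrm{ran}(A)},\ x\ne 0\}$, and the $A$-numerical radius is $\omega_A(T)=\sup\{|\langle Tx,x\rangle_A| : x\in\mathcal{H},\ \|x\|_A=1\}$. On $\mathcal{H}\oplus\mathcal{H}$ let $\mathbb{A}=\begin{bmatrix}A&0\\0&A\end{bmatrix}$; $\omega_{\mathbb{A}}$ is defined as $\omega_A$ with $\mathbb{A}$ in place of $A$. $\omega_{\mathbb{A}}^s(T)$ means $(\omega_{\mathbb{A}}(T))^s$. *)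

theory Defs
  imports "HOL-Analysis.Analysis"
begin

text \<open>
  Complex Hilbert spaces are built on top of \<open>real_inner\<close>, so that norm, topology and completeness
  are those of the library: the real inner product is the real part of the complex one, and the
  norm is \<open>norm x = sqrt (x \<bullet> x)\<close>. The complex inner product is linear in its first argument and
  conjugate linear in the second. Its positivity and definiteness follow from those of \<open>(\<bullet>)\<close>.
\<close>

class complex_hilbert_space = real_inner + complete_space +
  fixes scaleC :: "complex \<Rightarrow> 'a \<Rightarrow> 'a" (infixr "*\<^sub>C" 75)
    and cinner :: "'a \<Rightarrow> 'a \<Rightarrow> complex"
  assumes scaleC_add_right: "c *\<^sub>C (x + y) = c *\<^sub>C x + c *\<^sub>C y"
    and scaleC_add_left: "(c + d) *\<^sub>C x = c *\<^sub>C x + d *\<^sub>C x"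
    and scaleC_scaleC: "c *\<^sub>C (d *\<^sub>C x) = (c * d) *\<^sub>C x"
    and scaleC_of_real: "complex_of_real r *\<^sub>C x = r *\<^sub>R x"
    and cinner_commute: "cinner x y = cnj (cinner y x)"
    and cinner_add_left: "cinner (x + y) z = cinner x z + cinner y z"
    and cinner_scaleC_left: "cinner (c *\<^sub>C x) y = c * cinner x y"
    and inner_eq_Re_cinner: "x \<bullet> y = Re (cinner x y)"

instantiation complex :: complex_hilbert_space
begin

definition scaleC_complex :: "complex \<Rightarrow> complex \<Rightarrow> complex"
  where "scaleC_complex c x = c * x"

definition cinner_complex :: "complex \<Rightarrow> complex \<Rightarrow> complex"
  where "cinner_complex x y = x * cnj y"

instance
  by standard
    (simp_all add: scaleC_complex_def cinner_complex_def algebra_simps scaleR_conv_of_real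
      inner_complex_def)

end

text \<open>The Hilbert space direct sum; its norm is the library's \<open>norm (x, y) = sqrt (norm x ^ 2 + norm y ^ 2)\<close>.\<close>

instantiation prod :: (complex_hilbert_space, complex_hilbert_space) complex_hilbert_space
begin

definition scaleC_prod :: "complex \<Rightarrow> 'a \<times> 'b \<Rightarrow> 'a \<times> 'b"
  where "scaleC_prod c x = (c *\<^sub>C fst x, c *\<^sub>C snd x)"

definition cinner_prod :: "'a \<times> 'b \<Rightarrow> 'a \<times> 'b \<Rightarrow> complex"
  where "cinner_prod x y = cinner (fst x) (fst y) + cinner (snd x) (snd y)"

instance
proof
  fix x y :: "'a \<times> 'b"
  show "cinner x y = cnj (cinner y x)"
    unfolding cinner_prod_def complex_cnj_add
    by (simp flip: cinner_commute)
qed (simp_all add: scaleC_prod_def cinner_prod_def scaleC_add_right scaleC_add_left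
      scaleC_scaleC scaleC_of_real cinner_add_left cinner_scaleC_left inner_prod_def
      inner_eq_Re_cinner scaleR_prod_def algebra_simps)

end

definition bounded_clinear :: "('a::complex_hilbert_space \<Rightarrow> 'a) \<Rightarrow> bool"
  where "bounded_clinear T \<longleftrightarrow> bounded_linear T \<and> (\<forall>c x. T (c *\<^sub>C x) = c *\<^sub>C T x)"

definition cadjoint :: "('a::complex_hilbert_space \<Rightarrow> 'a) \<Rightarrow> 'a \<Rightarrow> 'a"
  where "cadjoint T = (THE S. bounded_clinear S \<and> (\<forall>x y. cinner (T x) y = cinner x (S y)))"

definition positive_op :: "('a::complex_hilbert_space \<Rightarrow> 'a) \<Rightarrow> bool"
  where "positive_op A \<longleftrightarrow>
    bounded_clinear A \<and> (\<forall>x. cinner (A x) x \<in> \<real> \<and> 0 \<le> Re (cinner (A x) x))"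

definition A_inner :: "('a::complex_hilbert_space \<Rightarrow> 'a) \<Rightarrow> 'a \<Rightarrow> 'a \<Rightarrow> complex"
  where "A_inner A x y = cinner (A x) y"

definition A_norm :: "('a::complex_hilbert_space \<Rightarrow> 'a) \<Rightarrow> 'a \<Rightarrow> real"
  where "A_norm A x = sqrt (Re (A_inner A x x))"

definition A_adjointable :: "('a::complex_hilbert_space \<Rightarrow> 'a) \<Rightarrow> ('a \<Rightarrow> 'a) set"
  where "A_adjointable A =
    {T. bounded_clinear T \<and> (\<exists>S. bounded_clinear S \<and> A \<circ> S = cadjoint T \<circ> A)}"

text \<open>
  The Moore-Penrose inverse is in general densely defined only: for \<open>y\<close> in \<open>ran A + (ran A)\<^sup>\<bottom>\<close> its
  value is the unique \<open>x\<close> in \<open>(ker A)\<^sup>\<bottom>\<close> for which \<open>A x\<close> is the orthogonal projection of \<open>y\<close> onto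
  the closure of \<open>ran A\<close>. Elsewhere the value is meaningless.
\<close>

definition mp_inverse :: "('a::complex_hilbert_space \<Rightarrow> 'a) \<Rightarrow> 'a \<Rightarrow> 'a"
  where "mp_inverse A y =
    (THE x. (\<forall>z. cinner (y - A x) (A z) = 0) \<and> (\<forall>z. A z = 0 \<longrightarrow> cinner x z = 0))"

definition A_sharp :: "('a::complex_hilbert_space \<Rightarrow> 'a) \<Rightarrow> ('a \<Rightarrow> 'a) \<Rightarrow> 'a \<Rightarrow> 'a"
  where "A_sharp A T = mp_inverse A \<circ> cadjoint T \<circ> A"

text \<open>
  The element \<open>0\<close> is inserted so that the supremum over the empty set, which occurs for \<open>A = 0\<close>,
  is \<open>0\<close>; the quantities themselves are nonnegative. As suprema of reals the two definitions are
  meaningful only for operators that are bounded with respect to \<open>A_norm A\<close>, such as the elements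
  of \<open>A_adjointable A\<close>. The denominator in the first one never vanishes, because \<open>A\<close> is injective
  on the closure of its range.
\<close>

definition A_opnorm :: "('a::complex_hilbert_space \<Rightarrow> 'a) \<Rightarrow> ('a \<Rightarrow> 'a) \<Rightarrow> real"
  where "A_opnorm A T =
    Sup (insert 0 {A_norm A (T x) / A_norm A x | x. x \<in> closure (range A) \<and> x \<noteq> 0})"

definition A_numradius :: "('a::complex_hilbert_space \<Rightarrow> 'a) \<Rightarrow> ('a \<Rightarrow> 'a) \<Rightarrow> real"
  where "A_numradius A T = Sup (insert 0 {cmod (A_inner A (T x) x) | x. A_norm A x = 1})"

definition op_block ::
    "('a::complex_hilbert_space \<Rightarrow> 'a) \<Rightarrow> ('a \<Rightarrow> 'a) \<Rightarrow> ('a \<Rightarrow> 'a) \<Rightarrow> ('a \<Rightarrow> 'a) \<Rightarrow> 'a \<times> 'a \<Rightarrow> 'a \<times> 'a"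
  where "op_block P Q R S = (\<lambda>(u, v). (P u + Q v, R u + S v))"

abbreviation zero_op :: "'a::complex_hilbert_space \<Rightarrow> 'a"
  where "zero_op \<equiv> (\<lambda>_. 0)"

abbreviation plus_op :: "('a::complex_hilbert_space \<Rightarrow> 'a) \<Rightarrow> ('a \<Rightarrow> 'a) \<Rightarrow> 'a \<Rightarrow> 'a"
    (infixl "+\<^sub>o\<^sub>p" 65)
  where "S +\<^sub>o\<^sub>p T \<equiv> (\<lambda>x. S x + T x)"

lemma cinner_add_right: "cinner x (y + z) = cinner x y + cinner (x::'a::complex_hilbert_space) z"
  by (subst (1 2 3) cinner_commute) (simp add: cinner_add_left)

lemma cinner_scaleC_right: "cinner x (c *\<^sub>C y) = cnj c * cinner (x::'a::complex_hilbert_space) y"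
  by (subst (1 2) cinner_commute) (simp add: cinner_scaleC_left)

lemma cinner_diff_left: "cinner (x - y) z = cinner x z - cinner (y::'a::complex_hilbert_space) z"
  using cinner_add_left[of "x - y" y z] by simp

lemma cinner_self_eq_0: "cinner x x = 0 \<Longrightarrow> (x::'a::complex_hilbert_space) = 0"
  using inner_eq_Re_cinner[of x x] by simp

lemma positive_op_sym:
  assumes "positive_op A"
  shows "cinner (A x) y = cinner x (A y)"
proof -
  have lin: "A (u + v) = A u + A v" "A (c *\<^sub>C u) = c *\<^sub>C A u" for u v c
    using assms by (auto simp: positive_op_def bounded_clinear_def bounded_linear.linear linear_add)
  have re: "Im (cinner (A u) u) = 0" for u
    using assms by (auto simp: positive_op_def complex_is_Real_iff)
  have a: "Im (cinner (A x) y) + Im (cinner (A y) x) = 0"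
    using re[of "x + y"] re[of x] re[of y] by (simp add: lin cinner_add_left cinner_add_right)
  have b: "Re (cinner (A y) x) - Re (cinner (A x) y) = 0"
    using re[of "x + \<i> *\<^sub>C y"] re[of x] re[of y]
    by (simp add: lin cinner_add_left cinner_add_right cinner_scaleC_left cinner_scaleC_right)
  have "cinner (A x) y = cnj (cinner (A y) x)"
    using a b by (simp add: complex_eq_iff)
  thus ?thesis by (simp flip: cinner_commute)
qed

text \<open>
  For \<open>T\<close> in \<open>A_adjointable A\<close>, \<open>A_sharp A T\<close> is the unique bounded solution \<open>S\<close> of
  \<open>A \<circ> S = T\<^sup>* \<circ> A\<close> with range in the closure of the range of \<open>A\<close>.
\<close>

lemma A_sharp_eqI:
  assumes A: "positive_op A"
    and S: "A \<circ> S = cadjoint T \<circ> A" "range S \<subseteq> closure (range A)"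
  shows "A_sharp A T = S"
proof
  fix x
  have bl: "bounded_linear A"
    using A by (simp add: positive_op_def bounded_clinear_def)
  have diff: "A (u - v) = A u - A v" for u v
    using bl by (simp add: bounded_linear.linear linear_diff)
  have ortho: "cinner u z = 0" if "u \<in> closure (range A)" "A z = 0" for u z
  proof -
    have i: "v \<bullet> z = 0" if "v \<in> closure (range A)" "A z = 0" for v z
    proof -
      have "cinner w 0 = 0" for w :: 'a
        using cinner_add_right[of w 0 0] by simp
      hence "A w \<bullet> z = 0" for w
        using \<open>A z = 0\<close> by (simp add: inner_eq_Re_cinner positive_op_sym[OF A])
      hence "closure (range A) \<subseteq> {v. v \<bullet> z = 0}"
        by (intro closure_minimal) (auto intro!: closed_Collect_eq continuous_intros)
      thus ?thesis using that by auto
    qed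
    have "A (\<i> *\<^sub>C z) = 0"
      using A that(2) scaleC_add_right[of \<i> 0 "0::'a"]
      by (simp add: positive_op_def bounded_clinear_def)
    hence "Re (cinner u (\<i> *\<^sub>C z)) = 0" "Re (cinner u z) = 0"
      using i[of u] that by (simp_all add: inner_eq_Re_cinner)
    thus ?thesis by (simp add: cinner_scaleC_right complex_eq_iff)
  qed
  have AS: "A (S x) = cadjoint T (A x)"
    using S(1) by (metis comp_apply)
  have Sx: "S x \<in> closure (range A)"
    using S(2) by blast
  show "A_sharp A T x = S x"
    unfolding A_sharp_def comp_apply mp_inverse_def
  proof (rule the_equality)
    have "cinner 0 z = 0" for z :: 'a
      using cinner_add_left[of 0 0 z] by simp
    thus "(\<forall>z. cinner (cadjoint T (A x) - A (S x)) (A z) = 0) \<and> (\<forall>z. A z = 0 \<longrightarrow> cinner (S x) z = 0)"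
      using AS ortho[OF Sx] by simp
  next
    fix w
    assume w: "(\<forall>z. cinner (cadjoint T (A x) - A w) (A z) = 0) \<and> (\<forall>z. A z = 0 \<longrightarrow> cinner w z = 0)"
    have "cinner (A (S x - w)) (A (S x - w)) = 0"
      using w diff[of "S x" w] by (metis AS)
    hence k: "A (S x - w) = 0" by (rule cinner_self_eq_0)
    have "cinner (S x - w) (S x - w) = 0"
      using w k ortho[OF Sx, of "S x - w"] by (simp add: cinner_diff_left)
    thus "w = S x" using cinner_self_eq_0 by force
  qed
qed

end

theory Submission
  imports Defs
begin

text \<open>
  Split the block operator into its diagonal part \<open>D\<close> and its off-diagonal part \<open>O\<close>. For a unit
  vector \<open>z\<close> put \<open>a = D z\<close> and \<open>b = O\<^sup>\<sharp> z\<close>, so that the quadratic form at \<open>z\<close> is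
  \<open>\<langle>a, z\<rangle> + \<langle>z, b\<rangle>\<close>. By Cauchy--Schwarz its squared modulus is at most \<open>S + 2 w\<close>, where
  \<open>S = \<parallel>a\<parallel>\<^sup>2 + \<parallel>b\<parallel>\<^sup>2\<close> and \<open>w = \<bar>\<langle>a, b\<rangle>\<bar> = \<bar>\<langle>O D z, z\<rangle>\<bar>\<close>. Writing \<open>N\<^sub>1\<close> and \<open>N\<^sub>2\<close> for the maxima of
  seminorms of sums and of sums of squares, one has \<open>S \<le> N\<^sub>1\<close> and \<open>S\<^sup>2 \<le> 2 N\<^sub>2\<close>, and \<open>w\<close> is at most
  the numerical radius of \<open>O D\<close>. It remains to bound \<open>(S + 2 w)\<^sup>2\<close>, for which \<open>2 w \<le> S\<close> and
  \<open>\<bar>\<alpha>\<bar> \<le> 1 + max 1 \<bar>\<alpha> - 1\<bar>\<close> suffice.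
\<close>

section \<open>Projections and adjoints in Hilbert space\<close>

text \<open>A sequence in \<open>V\<close> minimizing the distance to \<open>p\<close> is Cauchy by
  the parallelogram law. Its limit attains the minimum, which forces the residual to be orthogonal
  to \<open>V\<close>.\<close>

lemma closed_subspace_projection:
  fixes V :: "'a::{real_inner,complete_space} set"
  assumes V: "closed V" "subspace V"
  shows "\<exists>v\<in>V. \<forall>w\<in>V. (p - v) \<bullet> w = 0"
proof -
  define D where "D = (\<lambda>v. (norm (p - v))\<^sup>2) ` V"
  define d where "d = Inf D"
  have D: "D \<noteq> {}" "bdd_below D"
    using subspace_0[OF V(2)] by (auto simp: D_def intro!: bdd_belowI[of _ 0])
  have lower: "d \<le> (norm (p - v))\<^sup>2" if "v \<in> V" for v
    unfolding d_def using that D by (intro cInf_lower) (auto simp: D_def)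
  have "\<exists>v\<in>V. (norm (p - v))\<^sup>2 < d + 1 / (real n + 1)" for n
    using cInf_lessD[OF D(1), of "d + 1 / (real n + 1)"] by (auto simp: d_def D_def)
  then obtain v where vV: "\<And>n. v n \<in> V"
    and v: "\<And>n. (norm (p - v n))\<^sup>2 < d + 1 / (real n + 1)"
    by metis
  \<comment> \<open>Parallelogram identity: the midpoint of \<open>v m\<close> and
    \<open>v n\<close> lies in \<open>V\<close>, so its squared distance from \<open>p\<close> is at
    least \<open>d\<close>.\<close>
  have near: "(norm (v m - v n))\<^sup>2 \<le> 2 * (1 / (real m + 1)) + 2 * (1 / (real n + 1))" for m n
  proof -
    have "(norm (v m - v n))\<^sup>2 =
        2 * (norm (p - v m))\<^sup>2 + 2 * (norm (p - v n))\<^sup>2 - 4 * (norm (p - (1/2) *\<^sub>R (v m + v n)))\<^sup>2"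
      by (simp add: power2_norm_eq_inner algebra_simps inner_commute)
    moreover have "(1/2) *\<^sub>R (v m + v n) \<in> V"
      using V(2) vV by (simp add: subspace_add subspace_scale)
    ultimately show ?thesis
      using lower[of "(1/2) *\<^sub>R (v m + v n)"] v[of m] v[of n] by linarith
  qed
  have "Cauchy v"
  proof (rule metric_CauchyI)
    fix e :: real assume e: "e > 0"
    obtain N where N: "4 / e\<^sup>2 < real N"
      using reals_Archimedean2 by blast
    show "\<exists>M. \<forall>m\<ge>M. \<forall>n\<ge>M. dist (v m) (v n) < e"
    proof (intro exI allI impI)
      fix m n assume mn: "N \<le> m" "N \<le> n"
      have b: "2 * (1 / (real k + 1)) < e\<^sup>2 / 2" if "N \<le> k" for k
      proof -
        have "4 / e\<^sup>2 < real k + 1" using N that by linarith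
        then show ?thesis using e by (simp add: field_simps)
      qed
      have "(norm (v m - v n))\<^sup>2 < e\<^sup>2"
        using near[of m n] b[OF mn(1)] b[OF mn(2)] by linarith
      then show "dist (v m) (v n) < e"
        using e by (simp add: dist_norm power2_less_imp_less)
    qed
  qed
  then obtain l where l: "v \<longlonglongrightarrow> l"
    using Cauchy_convergent convergent_def by blast
  have lV: "l \<in> V"
    using V(1) vV l closed_sequentially by blast
  have "(\<lambda>n. (norm (p - v n))\<^sup>2) \<longlonglongrightarrow> (norm (p - l))\<^sup>2"
    by (intro tendsto_intros l)
  moreover have "(\<lambda>n. d + 1 / (real n + 1)) \<longlonglongrightarrow> d"
    using tendsto_add[OF tendsto_const[of d] LIMSEQ_inverse_real_of_nat]
    by (simp add: inverse_eq_divide add.commute)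
  ultimately have ld: "(norm (p - l))\<^sup>2 \<le> d"
    by (rule LIMSEQ_le) (use v less_imp_le in blast)
  have "(p - l) \<bullet> w = 0" if w: "w \<in> V" for w
  proof (cases "w = 0")
    case False
    \<comment> \<open>This \<open>t\<close> minimizes the squared norm of
      \<open>p - l - t *\<^sub>R w\<close>; a nonzero \<open>(p - l) \<bullet> w\<close> would push
      it below the minimum.\<close>
    define t where "t = ((p - l) \<bullet> w) / (w \<bullet> w)"
    have ww: "w \<bullet> w > 0" using False by simp
    have "l + t *\<^sub>R w \<in> V"
      using V(2) lV w by (simp add: subspace_add subspace_scale)
    from lower[OF this] ld have "(norm (p - l))\<^sup>2 \<le> (norm (p - l - t *\<^sub>R w))\<^sup>2"
      unfolding diff_diff_eq by linarith
    also have "\<dots> = (norm (p - l))\<^sup>2 - 2 * t * ((p - l) \<bullet> w) + t\<^sup>2 * (w \<bullet> w)"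
      unfolding power2_norm_eq_inner
      by (simp add: algebra_simps inner_commute power2_eq_square)
    also have "\<dots> = (norm (p - l))\<^sup>2 - ((p - l) \<bullet> w)\<^sup>2 / (w \<bullet> w)"
      using ww by (simp add: t_def power2_eq_square field_simps)
    finally show ?thesis
      using ww by (simp add: divide_le_0_iff)
  qed simp
  then show ?thesis using lV by blast
qed

lemma subspace_closure:
  fixes V :: "'a::real_normed_vector set"
  assumes V: "subspace V"
  shows "subspace (closure V)"
  unfolding subspace_def
proof (intro conjI ballI allI)
  show "0 \<in> closure V"
    using subspace_0[OF V] closure_subset by blast
next
  fix x y assume "x \<in> closure V" "y \<in> closure V"
  then obtain a b where "\<And>n. a n \<in> V" "a \<longlonglongrightarrow> x" "\<And>n. b n \<in> V" "b \<longlonglongrightarrow> y"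
    unfolding closure_sequential by blast
  then show "x + y \<in> closure V"
    unfolding closure_sequential
    by (intro exI[of _ "\<lambda>n. a n + b n"]) (simp add: subspace_add[OF V] tendsto_add)
next
  fix c x assume "x \<in> closure V"
  then obtain a where "\<And>n. a n \<in> V" "a \<longlonglongrightarrow> x"
    unfolding closure_sequential by blast
  then show "c *\<^sub>R x \<in> closure V"
    unfolding closure_sequential
    by (intro exI[of _ "\<lambda>n. c *\<^sub>R a n"]) (simp add: subspace_scale[OF V] tendsto_scaleR)
qed

text \<open>With \<open>n\<close> normal to the kernel and \<open>f n\<close> nonzero,
  \<open>x - (f x / f n) *\<^sub>R n\<close> lies in the kernel and is therefore orthogonal to
  \<open>n\<close>, which gives \<open>f x\<close> as a multiple of
  \<open>x \<bullet> n\<close>.\<close>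

lemma riesz_representation:
  fixes f :: "'a::{real_inner,complete_space} \<Rightarrow> real"
  assumes f: "bounded_linear f"
  shows "\<exists>s. \<forall>x. f x = x \<bullet> s"
proof (cases "\<forall>x. f x = 0")
  case True
  then show ?thesis by (intro exI[of _ 0]) simp
next
  case False
  interpret f: bounded_linear f by fact
  let ?V = "{x. f x = 0}"
  obtain p where p: "f p \<noteq> 0" using False by blast
  have "closed ?V"
    by (intro closed_Collect_eq f.continuous_on continuous_intros)
  moreover have "subspace ?V"
    by (auto simp: subspace_def f.zero f.add f.scaleR)
  ultimately obtain v where v: "f v = 0" "\<And>w. f w = 0 \<Longrightarrow> (p - v) \<bullet> w = 0"
    using closed_subspace_projection[of ?V p] by auto
  define n where "n = p - v"
  have fn: "f n \<noteq> 0" using p v by (simp add: n_def f.diff)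
  then have nn: "n \<bullet> n \<noteq> 0" using f.zero by auto
  have "f x = x \<bullet> ((f n / (n \<bullet> n)) *\<^sub>R n)" for x
  proof -
    have "f (x - (f x / f n) *\<^sub>R n) = 0"
      using fn by (simp add: f.diff f.scaleR)
    from v(2)[OF this] have "x \<bullet> n = f x / f n * (n \<bullet> n)"
      by (simp add: n_def inner_diff_right inner_commute)
    then show ?thesis using fn nn by simp
  qed
  then show ?thesis by blast
qed

lemma cinner_eqI:
  fixes y z :: "'a::complex_hilbert_space"
  assumes "\<And>x. cinner x y = cinner x z"
  shows "y = z"
proof -
  have "(y - z) \<bullet> y = (y - z) \<bullet> z"
    using assms by (simp add: inner_eq_Re_cinner)
  then have "(y - z) \<bullet> (y - z) = 0"
    by (simp add: inner_diff_right)
  then show ?thesis by simp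
qed

lemma norm_scaleC: "norm (c *\<^sub>C x) = cmod c * norm (x::'a::complex_hilbert_space)"
proof -
  have "cinner (c *\<^sub>C x) (c *\<^sub>C x) = complex_of_real ((cmod c)\<^sup>2) * cinner x x"
    unfolding complex_norm_square by (simp add: cinner_scaleC_left cinner_scaleC_right)
  then have "(c *\<^sub>C x) \<bullet> (c *\<^sub>C x) = (cmod c)\<^sup>2 * (x \<bullet> x)"
    by (simp add: inner_eq_Re_cinner)
  then show ?thesis
    by (simp add: norm_eq_sqrt_inner real_sqrt_mult)
qed

lemma bounded_linear_scaleC: "bounded_linear (\<lambda>x::'a::complex_hilbert_space. c *\<^sub>C x)"
proof (rule bounded_linear_intro[of _ "cmod c"])
  fix r x
  show "c *\<^sub>C (r *\<^sub>R x) = r *\<^sub>R (c *\<^sub>C (x::'a))"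
    unfolding scaleC_of_real[symmetric] scaleC_scaleC by (simp add: mult.commute)
qed (simp_all add: scaleC_add_right norm_scaleC)

lemma bounded_clinearD:
  assumes "bounded_clinear T"
  shows "bounded_linear T" "T (x + y) = T x + T y" "T (x - y) = T x - T y" "T (c *\<^sub>C x) = c *\<^sub>C T x"
    "T 0 = 0"
  using assms
  by (auto simp: bounded_clinear_def bounded_linear.linear linear_add linear_diff linear_0)

lemma bounded_clinearI:
  assumes "\<And>x y. T (x + y) = T x + T y" "\<And>c x. T (c *\<^sub>C x) = c *\<^sub>C T x"
    and "\<And>x. norm (T x) \<le> norm x * K"
  shows "bounded_clinear T"
  unfolding bounded_clinear_def
proof (intro conjI allI bounded_linear_intro[of _ K] assms)
  show "T (r *\<^sub>R x) = r *\<^sub>R T x" for r x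
    unfolding scaleC_of_real[symmetric] by (rule assms)
qed

lemma bounded_clinear_compose:
  assumes "bounded_clinear S" "bounded_clinear T"
  shows "bounded_clinear (S \<circ> T)"
  using assms bounded_linear_compose[of S T] by (auto simp: bounded_clinear_def o_def)

lemma bounded_clinear_add:
  assumes "bounded_clinear S" "bounded_clinear T"
  shows "bounded_clinear (S +\<^sub>o\<^sub>p T)"
  using assms bounded_linear_add[of S T] by (auto simp: bounded_clinear_def scaleC_add_right)

text \<open>Since \<open>cadjoint\<close> is a definite description, a bounded adjoint has to be
  constructed and shown unique. Riesz representation provides it for the real inner product.\<close>

lemma cinner_cadjoint:
  fixes T :: "'a::complex_hilbert_space \<Rightarrow> 'a"
  assumes T: "bounded_clinear T"
  shows "cinner (T x) y = cinner x (cadjoint T y)"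
proof -
  note bl = bounded_clinearD(1)[OF T]
  have "\<exists>s. \<forall>x. T x \<bullet> y = x \<bullet> s" for y
    by (rule riesz_representation)
      (rule bounded_linear_compose[OF bounded_linear_inner_left bl])
  then obtain S where S: "T x \<bullet> y = x \<bullet> S y" for x y by metis
  have adj: "cinner (T x) y = cinner x (S y)" for x y
  proof (rule complex_eqI)
    show "Re (cinner (T x) y) = Re (cinner x (S y))"
      using S[of x y] by (simp add: inner_eq_Re_cinner)
    \<comment> \<open>The real part of \<open>\<i> * c\<close> is \<open>- Im c\<close>, so the real
      identity at \<open>\<i> *\<^sub>C x\<close> is the imaginary one at \<open>x\<close>.\<close>
    show "Im (cinner (T x) y) = Im (cinner x (S y))"
      using S[of "\<i> *\<^sub>C x" y]
      by (simp add: inner_eq_Re_cinner bounded_clinearD(4)[OF T] cinner_scaleC_left)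
  qed
  obtain B where B: "B > 0" "\<And>x. norm (T x) \<le> norm x * B"
    using bounded_linear.pos_bounded[OF bl] by blast
  have "bounded_clinear S"
  proof (rule bounded_clinearI[of _ B])
    show "S (x + y) = S x + S y" for x y
      by (rule cinner_eqI) (simp add: cinner_add_right flip: adj)
    show "S (c *\<^sub>C x) = c *\<^sub>C S x" for c x
      by (rule cinner_eqI) (simp add: cinner_scaleC_right flip: adj)
    show "norm (S x) \<le> norm x * B" for x
    proof (cases "S x = 0")
      case False
      \<comment> \<open>The adjoint relation is tested at the vector \<open>S x\<close>; one factor
        \<open>norm (S x)\<close> cancels at the end.\<close>
      have "norm (S x) * norm (S x) = T (S x) \<bullet> x"
        by (simp add: S power2_norm_eq_inner flip: power2_eq_square)
      also have "\<dots> \<le> norm (T (S x)) * norm x"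
        by (rule norm_cauchy_schwarz)
      also have "\<dots> \<le> norm (S x) * B * norm x"
        by (intro mult_right_mono B norm_ge_zero)
      finally show ?thesis
        using False by (simp add: mult_ac)
    qed (use B in simp)
  qed
  moreover from adj have "S' = S" if "\<forall>x y. cinner (T x) y = cinner x (S' y)" for S'
    using that by (intro ext) (rule cinner_eqI, simp)
  ultimately have "cadjoint T = S"
    unfolding cadjoint_def using adj by (intro the_equality) auto
  then show ?thesis by (simp add: adj)
qed

section \<open>The semi-inner product of a positive operator\<close>

locale positive_operator =
  fixes A :: "'a::complex_hilbert_space \<Rightarrow> 'a"
  assumes pos: "positive_op A"
begin

abbreviation ip (infix "\<diamondop>" 70) where "ip \<equiv> A_inner A"

lemma clin: "bounded_clinear A"
  using pos by (simp add: positive_op_def)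

lemmas A_lin = bounded_clinearD(2-)[OF clin]

lemma ip_add_left: "(x + y) \<diamondop> z = x \<diamondop> z + y \<diamondop> z"
  by (simp add: A_inner_def A_lin cinner_add_left)

lemma ip_add_right: "z \<diamondop> (x + y) = z \<diamondop> x + z \<diamondop> y"
  by (simp add: A_inner_def cinner_add_right)

lemma ip_scaleC_left: "(c *\<^sub>C x) \<diamondop> y = c * (x \<diamondop> y)"
  by (simp add: A_inner_def A_lin cinner_scaleC_left)

lemma ip_scaleC_right: "x \<diamondop> (c *\<^sub>C y) = cnj c * (x \<diamondop> y)"
  by (simp add: A_inner_def cinner_scaleC_right)

lemma ip_commute: "x \<diamondop> y = cnj (y \<diamondop> x)"
  unfolding A_inner_def by (simp add: positive_op_sym[OF pos] flip: cinner_commute)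

lemma ip_self: "x \<diamondop> x = complex_of_real ((A_norm A x)\<^sup>2)"
  using pos unfolding positive_op_def A_norm_def A_inner_def
  by (auto simp: complex_is_Real_iff complex_eq_iff)

lemma Re_ip_self: "Re (x \<diamondop> x) = (A_norm A x)\<^sup>2"
  by (simp only: ip_self Re_complex_of_real)

lemma A_norm_nonneg [simp]: "0 \<le> A_norm A x"
  using pos by (simp add: A_norm_def A_inner_def positive_op_def)

lemma A_norm_add: "(A_norm A (x + y))\<^sup>2 = (A_norm A x)\<^sup>2 + 2 * Re (x \<diamondop> y) + (A_norm A y)\<^sup>2"
proof -
  have "Re ((x + y) \<diamondop> (x + y)) = Re (x \<diamondop> x) + Re (x \<diamondop> y) + Re (y \<diamondop> x) + Re (y \<diamondop> y)"
    by (simp add: ip_add_left ip_add_right)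
  moreover have "Re (y \<diamondop> x) = Re (x \<diamondop> y)"
    by (subst ip_commute) simp
  ultimately show ?thesis by (simp add: Re_ip_self)
qed

lemma A_norm_scaleC: "A_norm A (c *\<^sub>C x) = cmod c * A_norm A x"
proof -
  have "(c *\<^sub>C x) \<diamondop> (c *\<^sub>C x) = complex_of_real ((cmod c)\<^sup>2) * (x \<diamondop> x)"
    unfolding complex_norm_square by (simp add: ip_scaleC_left ip_scaleC_right)
  then have "Re ((c *\<^sub>C x) \<diamondop> (c *\<^sub>C x)) = (cmod c)\<^sup>2 * Re (x \<diamondop> x)"
    by simp
  then have "(A_norm A (c *\<^sub>C x))\<^sup>2 = (cmod c * A_norm A x)\<^sup>2"
    unfolding Re_ip_self power_mult_distrib .
  then show ?thesis by simp
qed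

text \<open>The scalar \<open>c\<close> undoes the phase of \<open>x \<diamondop> y\<close>. It
  turns a modulus into a real part, so that complex estimates reduce to real ones.\<close>

lemma ip_rotate:
  obtains c where "cmod c = 1" "\<And>z. (c *\<^sub>C x) \<diamondop> z = c * (x \<diamondop> z)" "c * (x \<diamondop> y) = cmod (x \<diamondop> y)"
proof (cases "x \<diamondop> y = 0")
  case True
  show ?thesis by (rule that[of 1]) (simp_all add: True ip_scaleC_left)
next
  case False
  let ?c = "cnj (x \<diamondop> y) / cmod (x \<diamondop> y)"
  have "?c * (x \<diamondop> y) = cmod (x \<diamondop> y)"
    using False by (simp add: complex_norm_square[unfolded power2_eq_square of_real_mult] field_simps)
  then show ?thesis
    using False by (intro that[of ?c]) (simp_all add: norm_divide ip_scaleC_left)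
qed

text \<open>Discriminant argument for the seminorm of \<open>x + t y\<close>. As
  \<open>A_norm A y\<close> may vanish for nonzero \<open>y\<close>, the case without a quadratic
  term is treated separately.\<close>

lemma ip_cauchy_schwarz_Re: "Re (x \<diamondop> y) \<le> A_norm A x * A_norm A y"
proof -
  define p q r where "p = A_norm A x" and "q = A_norm A y" and "r = Re (x \<diamondop> y)"
  have quad: "0 \<le> p\<^sup>2 + 2 * t * r + t\<^sup>2 * q\<^sup>2" for t
    using zero_le_power2[of "A_norm A (x + complex_of_real t *\<^sub>C y)"]
    unfolding A_norm_add A_norm_scaleC ip_scaleC_right
    by (simp add: p_def q_def r_def power_mult_distrib)
  have "r\<^sup>2 \<le> p\<^sup>2 * q\<^sup>2"
  proof (cases "q = 0")
    case True
    have "r = 0"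
    proof (rule ccontr)
      assume "r \<noteq> 0"
      \<comment> \<open>With \<open>q = 0\<close> the expression in \<open>quad\<close> is affine in
        \<open>t\<close>, and this choice of \<open>t\<close> gives it the value -1.\<close>
      then show False
        using quad[of "- (p\<^sup>2 + 1) / (2 * r)"] by (simp add: True field_simps)
    qed
    then show ?thesis by simp
  next
    case False
    then show ?thesis
      using quad[of "- r / q\<^sup>2"] by (simp add: divide_simps power2_eq_square zero_le_divide_iff split: if_splits)
  qed
  then have "r\<^sup>2 \<le> (p * q)\<^sup>2" by (simp add: power_mult_distrib)
  moreover have "0 \<le> p * q" by (simp add: p_def q_def)
  ultimately have "r \<le> p * q" by (rule power2_le_imp_le)
  then show ?thesis by (simp add: p_def q_def r_def)
qed

lemma ip_cauchy_schwarz: "cmod (x \<diamondop> y) \<le> A_norm A x * A_norm A y"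
proof -
  obtain c where c: "cmod c = 1" "\<And>z. (c *\<^sub>C x) \<diamondop> z = c * (x \<diamondop> z)" "c * (x \<diamondop> y) = cmod (x \<diamondop> y)"
    using ip_rotate[where x = x and y = y] by metis
  have "cmod (x \<diamondop> y) = Re ((c *\<^sub>C x) \<diamondop> y)"
    by (simp add: c)
  also have "\<dots> \<le> A_norm A (c *\<^sub>C x) * A_norm A y"
    by (rule ip_cauchy_schwarz_Re)
  finally show ?thesis by (simp add: A_norm_scaleC c(1))
qed

text \<open>Both summands on the left are rotated to be nonnegative, so that Cauchy--Schwarz has to be
  applied only once, to a combination of \<open>a\<close> and \<open>b\<close> with unimodular coefficients.\<close>

lemma cmod_ip_sum_sq_le:
  assumes z: "A_norm A z = 1"
  shows "(cmod (a \<diamondop> z + z \<diamondop> b))\<^sup>2 \<le> (A_norm A a)\<^sup>2 + (A_norm A b)\<^sup>2 + 2 * cmod (a \<diamondop> b)"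
proof -
  obtain c where c: "cmod c = 1" "\<And>y. (c *\<^sub>C a) \<diamondop> y = c * (a \<diamondop> y)" "c * (a \<diamondop> z) = cmod (a \<diamondop> z)"
    using ip_rotate[where x = a and y = z] by metis
  obtain d where d: "cmod d = 1" "\<And>y. (d *\<^sub>C b) \<diamondop> y = d * (b \<diamondop> y)" "d * (b \<diamondop> z) = cmod (b \<diamondop> z)"
    using ip_rotate[where x = b and y = z] by metis
  have "cmod (a \<diamondop> z + z \<diamondop> b) \<le> cmod (a \<diamondop> z) + cmod (b \<diamondop> z)"
    using norm_triangle_ineq[of "a \<diamondop> z" "z \<diamondop> b"] ip_commute[of z b] by simp
  also have "\<dots> = Re ((c *\<^sub>C a + d *\<^sub>C b) \<diamondop> z)"
    by (simp add: ip_add_left c(2,3) d(2,3))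
  also have "\<dots> \<le> A_norm A (c *\<^sub>C a + d *\<^sub>C b)"
    using ip_cauchy_schwarz_Re[of "c *\<^sub>C a + d *\<^sub>C b" z] z by simp
  finally have "(cmod (a \<diamondop> z + z \<diamondop> b))\<^sup>2 \<le> (A_norm A (c *\<^sub>C a + d *\<^sub>C b))\<^sup>2"
    by (rule power_mono) simp
  also have "\<dots> = (A_norm A a)\<^sup>2 + (A_norm A b)\<^sup>2 + 2 * Re (c * cnj d * (a \<diamondop> b))"
    by (simp add: A_norm_add A_norm_scaleC c(1) d(1) ip_scaleC_left ip_scaleC_right mult_ac)
  also have "Re (c * cnj d * (a \<diamondop> b)) \<le> cmod (a \<diamondop> b)"
    using complex_Re_le_cmod[of "c * cnj d * (a \<diamondop> b)"] by (simp add: norm_mult c(1) d(1))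
  finally show ?thesis by simp
qed

section \<open>Vectors modulo the kernel of \<open>A\<close>, and the closure of its range\<close>

lemma ip_cong:
  assumes "A x = A x'"
  shows "x \<diamondop> y = x' \<diamondop> y" "y \<diamondop> x = y \<diamondop> x'"
  using assms by (simp_all add: A_inner_def positive_op_sym[OF pos, of y])

lemma A_norm_cong: "A x = A y \<Longrightarrow> A_norm A x = A_norm A y"
  using ip_cong[of x y] by (simp add: A_norm_def)

lemma real_sym: "A x \<bullet> y = x \<bullet> A y"
  by (simp add: inner_eq_Re_cinner positive_op_sym[OF pos])

lemma closure_range_subspace: "subspace (closure (range A))"
  by (intro subspace_closure linear_subspace_image subspace_UNIV bounded_linear.linear
      bounded_clinearD(1)[OF clin])

lemma closure_range_scaleC:
  assumes "x \<in> closure (range A)"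
  shows "c *\<^sub>C x \<in> closure (range A)"
proof -
  have "(\<lambda>x. c *\<^sub>C x) ` closure (range A) \<subseteq> closure (range A)"
  proof (rule image_closure_subset)
    show "continuous_on (closure (range A)) (\<lambda>x. c *\<^sub>C x)"
      by (rule bounded_linear.continuous_on[OF bounded_linear_scaleC continuous_on_id])
    have "c *\<^sub>C A y \<in> range A" for y
      using A_lin(3)[of c y] by (metis rangeI)
    then show "(\<lambda>x. c *\<^sub>C x) ` range A \<subseteq> closure (range A)"
      using closure_subset by blast
  qed auto
  then show ?thesis using assms by blast
qed

lemma closure_range_orthogonal_kernel:
  assumes "x \<in> closure (range A)" "A k = 0"
  shows "x \<bullet> k = 0"
proof -
  have "closure (range A) \<subseteq> {x. x \<bullet> k = 0}"
    by (rule closure_minimal)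
      (auto simp: real_sym assms(2) intro!: closed_Collect_eq continuous_intros)
  then show ?thesis using assms(1) by blast
qed

text \<open>Take the orthogonal projection \<open>s\<close> of \<open>x\<close>: the residual is
  orthogonal to \<open>A (A (x - s))\<close>, hence killed by \<open>A\<close>. This serves to
  choose the range of a solution and to reach all vectors from a supremum over the closure
  only.\<close>

lemma closure_range_representative:
  "\<exists>s \<in> closure (range A). A s = A x \<and> norm s \<le> norm x"
proof -
  obtain s where s: "s \<in> closure (range A)" "\<And>w. w \<in> closure (range A) \<Longrightarrow> (x - s) \<bullet> w = 0"
    using closed_subspace_projection[OF closed_closure closure_range_subspace] by blast
  have "A (x - s) \<bullet> A (x - s) = (x - s) \<bullet> A (A (x - s))"
    by (rule real_sym)
  also have "\<dots> = 0"
    by (rule s(2), rule subsetD[OF closure_subset], rule rangeI)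
  finally have k: "A (x - s) = 0"
    by simp
  have "(norm x)\<^sup>2 = (norm s)\<^sup>2 + 2 * ((x - s) \<bullet> s) + (norm (x - s))\<^sup>2"
    unfolding power2_norm_eq_inner by (simp add: algebra_simps inner_commute)
  also have "(x - s) \<bullet> s = 0"
    by (rule s(2)[OF s(1)])
  finally have "(norm s)\<^sup>2 \<le> (norm x)\<^sup>2"
    by simp
  then have "norm s \<le> norm x"
    by (rule power2_le_imp_le) simp
  then show ?thesis
    using s(1) k by (intro bexI[of _ s]) (simp_all add: A_lin)
qed

lemma closure_range_inj:
  assumes "x \<in> closure (range A)" "y \<in> closure (range A)" "A x = A y"
  shows "x = y"
proof -
  have "x - y \<in> closure (range A)"
    using assms closure_range_subspace by (intro subspace_diff)
  then have "(x - y) \<bullet> (x - y) = 0"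
    by (rule closure_range_orthogonal_kernel) (simp add: A_lin assms(3))
  then show ?thesis by simp
qed

text \<open>Composing a solution \<open>S\<close> of \<open>A \<circ> S = T\<^sup>* \<circ> A\<close> with the projection onto the closure of the range
  of \<open>A\<close> gives a solution with range in that closure, which is therefore \<open>A_sharp A T\<close>.\<close>

lemma A_sharp_properties:
  assumes T: "T \<in> A_adjointable A"
  shows bounded_clinear_A_sharp: "bounded_clinear (A_sharp A T)"
    and ip_A_sharp: "T x \<diamondop> y = x \<diamondop> A_sharp A T y"
proof -
  obtain S where Tb: "bounded_clinear T" and S: "bounded_clinear S" "A \<circ> S = cadjoint T \<circ> A"
    using T by (auto simp: A_adjointable_def)
  let ?R = "closure (range A)"
  obtain P where P: "\<And>x. P x \<in> ?R" "\<And>x. A (P x) = A (S x)" "\<And>x. norm (P x) \<le> norm (S x)"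
    using closure_range_representative[of "S _"] by metis
  obtain B where B: "\<And>x. norm (S x) \<le> norm x * B"
    using bounded_linear.pos_bounded[OF bounded_clinearD(1)[OF S(1)]] by blast
  have Pb: "bounded_clinear P"
  proof (rule bounded_clinearI[of _ B])
    \<comment> \<open>\<open>P\<close> is chosen pointwise; its linearity follows because
      \<open>A\<close> is injective on the closure of its range and both sides have the same
      image.\<close>
    show "P (x + y) = P x + P y" for x y
    proof (rule closure_range_inj)
      show "P x + P y \<in> ?R"
        using P(1) closure_range_subspace by (intro subspace_add)
    qed (simp_all add: P A_lin bounded_clinearD[OF S(1)])
    show "P (c *\<^sub>C x) = c *\<^sub>C P x" for c x
    proof (rule closure_range_inj)
      show "c *\<^sub>C P x \<in> ?R"
        by (intro closure_range_scaleC P(1))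
    qed (simp_all add: P A_lin bounded_clinearD[OF S(1)])
    show "norm (P x) \<le> norm x * B" for x
      using P(3)[of x] B[of x] by linarith
  qed
  have AS: "A (S x) = cadjoint T (A x)" for x
    using S(2) by (metis comp_apply)
  have "A_sharp A T = P"
    by (rule A_sharp_eqI[OF pos]) (use P in \<open>auto simp: fun_eq_iff AS\<close>)
  then show "bounded_clinear (A_sharp A T)" and "T x \<diamondop> y = x \<diamondop> A_sharp A T y"
    using Pb by (simp_all add: A_inner_def positive_op_sym[OF pos] cinner_cadjoint[OF Tb] P AS)
qed

lemma A_sharp_ip: "T \<in> A_adjointable A \<Longrightarrow> A_sharp A T x \<diamondop> y = x \<diamondop> T y"
  using ip_A_sharp[of T y x] ip_commute[of "A_sharp A T x" y] ip_commute[of x "T y"] by simp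

text \<open>Krein's argument: the seminorms of the iterates \<open>T\<^sup>n x\<close> are log-convex by Cauchy--Schwarz and
  grow at most like the powers of the operator norm of \<open>T\<close>.\<close>

lemma A_symmetric_bounded:
  assumes T: "bounded_clinear T" and sym: "\<And>x y. T x \<diamondop> y = x \<diamondop> T y"
  shows "\<exists>K. \<forall>x. A_norm A (T x) \<le> K * A_norm A x"
proof -
  obtain K where K: "K > 0" "\<And>x. norm (T x) \<le> norm x * K"
    using bounded_linear.pos_bounded[OF bounded_clinearD(1)[OF T]] by blast
  obtain C where C: "C > 0" "\<And>x. norm (A x) \<le> norm x * C"
    using bounded_linear.pos_bounded[OF bounded_clinearD(1)[OF clin]] by blast
  have A_norm_le: "A_norm A x \<le> sqrt C * norm x" for x
  proof -
    have "(A_norm A x)\<^sup>2 = A x \<bullet> x"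
      by (simp add: inner_eq_Re_cinner A_inner_def flip: Re_ip_self)
    also have "\<dots> \<le> norm (A x) * norm x"
      by (rule norm_cauchy_schwarz)
    also have "\<dots> \<le> norm x * C * norm x"
      by (intro mult_right_mono C norm_ge_zero)
    also have "\<dots> = (sqrt C * norm x)\<^sup>2"
      using C by (simp add: power_mult_distrib power2_eq_square)
    finally show ?thesis
      by (rule power2_le_imp_le) (use C in simp)
  qed
  have "A_norm A (T x) \<le> K * A_norm A x" for x
  proof (rule ccontr)
    assume neg: "\<not> ?thesis"
    define a where "a n = A_norm A ((T ^^ n) x)" for n
    have a_nonneg: "0 \<le> a n" for n
      by (simp add: a_def)
    \<comment> \<open>By symmetry, the squared seminorm of \<open>T^(n+1) x\<close> is the
      semi-inner product of \<open>T^n x\<close> and \<open>T^(n+2) x\<close>.\<close>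
    have log_convex: "(a (Suc n))\<^sup>2 \<le> a n * a (Suc (Suc n))" for n
      using ip_cauchy_schwarz_Re[of "(T ^^ n) x" "T (T ((T ^^ n) x))"]
      by (simp add: a_def sym flip: Re_ip_self)
    have gt: "K * a 0 < a 1"
      using neg by (simp add: a_def)
    have a1: "a 1 > 0"
      using gt mult_nonneg_nonneg[OF less_imp_le[OF K(1)] a_nonneg[of 0]] by linarith
    have a0: "a 0 > 0"
      using log_convex[of 0] a1 a_nonneg[of 0] by (cases "a 0 = 0") auto
    \<comment> \<open>Log-convexity makes the ratios of successive \<open>a n\<close> nondecreasing,
      so \<open>a\<close> grows at least like powers of the first ratio \<open>\<rho>\<close>. As
      \<open>\<rho>\<close> exceeds \<open>K\<close>, this contradicts the growth bound by powers of
      \<open>K\<close>.\<close>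
    define \<rho> where "\<rho> = a 1 / a 0"
    have \<rho>: "K < \<rho>" "\<rho> > 0"
      using gt a0 a1 by (simp_all add: \<rho>_def field_simps)
    have ratio: "0 < a n \<and> \<rho> * a n \<le> a (Suc n)" for n
    proof (induction n)
      case 0
      then show ?case using a0 by (simp add: \<rho>_def)
    next
      case (Suc n)
      have p: "0 < a (Suc n)"
        using Suc mult_pos_pos[of \<rho> "a n"] \<rho>(2) by linarith
      have "a n * (\<rho> * a (Suc n)) = (\<rho> * a n) * a (Suc n)"
        by simp
      also have "\<dots> \<le> a (Suc n) * a (Suc n)"
        using Suc p by (intro mult_right_mono) auto
      also have "\<dots> \<le> a n * a (Suc (Suc n))"
        using log_convex[of n] by (simp add: power2_eq_square)
      finally show ?case
        using Suc p by simp
    qed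
    have lower: "\<rho> ^ n * a 0 \<le> a n" for n
    proof (induction n)
      case (Suc n)
      have "\<rho> ^ Suc n * a 0 \<le> \<rho> * a n"
        using Suc \<rho> by simp
      then show ?case using ratio[of n] by linarith
    qed simp
    have "norm ((T ^^ n) x) \<le> norm x * K ^ n" for n
    proof (induction n)
      case (Suc n)
      have "norm ((T ^^ Suc n) x) \<le> norm ((T ^^ n) x) * K"
        using K by simp
      also have "\<dots> \<le> norm x * K ^ n * K"
        using Suc K by (intro mult_right_mono) auto
      finally show ?case by (simp add: mult_ac)
    qed simp
    then have upper: "a n \<le> sqrt C * (norm x * K ^ n)" for n
      unfolding a_def using C by (intro order_trans[OF A_norm_le] mult_left_mono) auto
    have "(\<rho> / K) ^ n \<le> sqrt C * norm x / a 0" for n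
      using order_trans[OF lower upper, of n] a0 K(1)
      by (simp add: power_divide divide_simps mult_ac)
    moreover have "1 < \<rho> / K"
      using \<rho> K(1) by simp
    ultimately show False
      using real_arch_pow[of "\<rho> / K" "sqrt C * norm x / a 0"] by (meson leD)
  qed
  then show ?thesis by blast
qed

section \<open>The A-operator seminorm of symmetric operators\<close>

context
  fixes T
  assumes T: "bounded_clinear T" and sym: "\<And>x y. T x \<diamondop> y = x \<diamondop> T y"
begin

text \<open>A supremum of reals says nothing without boundedness, which the seminorm bound for
  symmetric operators supplies.\<close>

lemma bdd_above_A_opnorm:
  "bdd_above (insert 0 {A_norm A (T x) / A_norm A x | x. x \<in> closure (range A) \<and> x \<noteq> 0})"
proof -
  obtain K where K: "\<And>x. A_norm A (T x) \<le> K * A_norm A x"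
    using A_symmetric_bounded[OF T sym] by blast
  \<comment> \<open>The bound \<open>K\<close> comes without a sign, and the quotient is 0 when its
    denominator is 0; \<open>max 0\<close> covers both.\<close>
  have "A_norm A (T x) / A_norm A x \<le> max 0 K" for x
  proof (cases "A_norm A x = 0")
    case False
    then have "A_norm A x > 0"
      using A_norm_nonneg[of x] by linarith
    then show ?thesis
      using K[of x] by (simp add: pos_divide_le_eq le_max_iff_disj)
  qed simp
  then show ?thesis
    by (intro bdd_aboveI[of _ "max 0 K"]) auto
qed

lemma A_opnorm_nonneg: "0 \<le> A_opnorm A T"
  unfolding A_opnorm_def by (rule cSup_upper[OF _ bdd_above_A_opnorm]) simp

lemma A_norm_le_A_opnorm:
  assumes "x \<in> closure (range A)"
  shows "A_norm A (T x) \<le> A_opnorm A T * A_norm A x"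
proof (cases "A_norm A x = 0")
  case True
  obtain K where "\<And>x. A_norm A (T x) \<le> K * A_norm A x"
    using A_symmetric_bounded[OF T sym] by blast
  from this[of x] show ?thesis by (simp add: True)
next
  case False
  then have "x \<noteq> 0"
    by (auto simp: A_norm_def A_inner_def A_lin inner_eq_Re_cinner[symmetric])
  then have "A_norm A (T x) / A_norm A x \<le> A_opnorm A T"
    unfolding A_opnorm_def using assms by (intro cSup_upper bdd_above_A_opnorm) blast
  moreover have "A_norm A x > 0"
    using False A_norm_nonneg[of x] by linarith
  ultimately show ?thesis
    by (simp add: pos_divide_le_eq)
qed

text \<open>The supremum sees only the closure of the range, but by symmetry of \<open>T\<close> the
  quadratic form depends on \<open>x\<close> only modulo the kernel of \<open>A\<close>, so
  \<open>x\<close> may be replaced by its representative.\<close>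

lemma ip_le_A_opnorm: "Re (T x \<diamondop> x) \<le> A_opnorm A T * (A_norm A x)\<^sup>2"
proof -
  obtain s where s: "s \<in> closure (range A)" "A s = A x"
    using closure_range_representative by blast
  have "T x \<diamondop> x = T s \<diamondop> s"
    using ip_cong[OF s(2)] by (simp add: sym)
  then have "Re (T x \<diamondop> x) \<le> A_norm A (T s) * A_norm A s"
    using ip_cauchy_schwarz_Re[of "T s" s] by simp
  also have "\<dots> \<le> A_opnorm A T * A_norm A s * A_norm A s"
    by (intro mult_right_mono A_norm_le_A_opnorm s A_norm_nonneg)
  finally show ?thesis
    by (simp add: A_norm_cong[OF s(2)] power2_eq_square)
qed

end

end


section \<open>The block operator\<close>

text \<open>This makes the theory of the semi-inner product available on the direct sum.\<close>

lemma positive_op_diag: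
  assumes "positive_op A"
  shows "positive_op (op_block A zero_op zero_op A)"
proof -
  interpret positive_operator A by standard fact
  have AA: "op_block A zero_op zero_op A = (\<lambda>z. (A (fst z), A (snd z)))"
    by (auto simp: op_block_def fun_eq_iff)
  have "bounded_linear (\<lambda>z. (A (fst z), A (snd z)))"
    by (intro bounded_linear_Pair bounded_linear_compose[OF bounded_clinearD(1)[OF clin]]
        bounded_linear_fst bounded_linear_snd)
  then show ?thesis
    using assms by (auto simp: positive_op_def bounded_clinear_def AA scaleC_prod_def cinner_prod_def)
qed

text \<open>With \<open>d = S - 2 * w\<close> the difference of the two sides becomes a polynomial in \<open>d\<close> and \<open>w\<close> with
  nonnegative coefficients.\<close>

lemma quadratic_form_bound:
  fixes S w m t c :: real
  assumes w: "0 \<le> w" "2 * w \<le> S" and t: "t \<le> 1" and m: "1 \<le> m" and c: "0 \<le> c" "c \<le> m + 1"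
  shows "4 * S * w * c\<^sup>2 \<le> 3 * (1 - t + m\<^sup>2) * S\<^sup>2 + 2 * (t + 2 * m) * (S * w) + 8 * t * w\<^sup>2"
proof -
  define d where "d = S - 2 * w"
  have d: "0 \<le> d" "S = d + 2 * w" using w by (simp_all add: d_def)
  have "4 * S * w * c\<^sup>2 \<le> 4 * S * w * (m + 1)\<^sup>2"
    using w c by (intro mult_left_mono power_mono) auto
  also have "\<dots> = 3 * (1 - t + m\<^sup>2) * S\<^sup>2 + 2 * (t + 2 * m) * (S * w) + 8 * t * w\<^sup>2
      - ((1 - t) * (3 * d\<^sup>2 + 10 * (d * w)) + 3 * m\<^sup>2 * d\<^sup>2
        + (4 * (m * (m - 1)) + 4 * m\<^sup>2 - 2) * (d * w) + 4 * ((m - 1) * w)\<^sup>2)"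
    unfolding d(2) by (simp add: power2_eq_square algebra_simps)
  also have "\<dots> \<le> 3 * (1 - t + m\<^sup>2) * S\<^sup>2 + 2 * (t + 2 * m) * (S * w) + 8 * t * w\<^sup>2"
  proof -
    have "1 \<le> m\<^sup>2" "0 \<le> m * (m - 1)"
      using m by simp_all
    then have "0 \<le> (4 * (m * (m - 1)) + 4 * m\<^sup>2 - 2) * (d * w)"
      using d w by (intro mult_nonneg_nonneg) auto
    moreover have "0 \<le> (1 - t) * (3 * d\<^sup>2 + 10 * (d * w))"
      using d w t by (intro mult_nonneg_nonneg add_nonneg_nonneg) auto
    moreover have "0 \<le> 3 * m\<^sup>2 * d\<^sup>2" "0 \<le> 4 * ((m - 1) * w)\<^sup>2"
      by simp_all
    ultimately show ?thesis by linarith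
  qed
  finally show ?thesis .
qed

text \<open>Only the cross term \<open>4 * S * w\<close> of the square needs work: the quadratic
  bound, divided by the squared modulus of \<open>\<alpha>\<close>, has exactly the coefficients
  \<open>\<chi>\<^sub>1 + \<chi>\<^sub>3\<close>, \<open>2 * \<chi>\<^sub>2\<close> and
  \<open>4 * \<chi>\<^sub>4\<close>.\<close>

lemma fourth_power_bound:
  fixes S w N\<^sub>1 N\<^sub>2 \<Omega> \<mu> \<beta> :: real and \<alpha> :: complex
  defines "\<chi>\<^sub>1 \<equiv> (\<beta> + (\<beta> + 1) * max 1 ((cmod (\<alpha> - 1))\<^sup>2)) / ((cmod \<alpha>)\<^sup>2 * (\<beta> + 1))"
    and "\<chi>\<^sub>2 \<equiv> (1 + 2 * (\<beta> + 1) * max 1 (cmod (\<alpha> - 1))) / ((cmod \<alpha>)\<^sup>2 * (\<beta> + 1))"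
    and "\<chi>\<^sub>3 \<equiv> (2 * \<beta> + 2 * (\<beta> + 1) * max 1 ((cmod (\<alpha> - 1))\<^sup>2)) / ((cmod \<alpha>)\<^sup>2 * (\<beta> + 1))"
    and "\<chi>\<^sub>4 \<equiv> 2 / ((cmod \<alpha>)\<^sup>2 * (\<beta> + 1))"
  assumes w: "0 \<le> w" "2 * w \<le> S"
    and N: "S \<le> N\<^sub>1" "S\<^sup>2 \<le> 2 * N\<^sub>2" "w \<le> \<Omega>"
    and \<mu>: "0 \<le> \<mu>" "\<mu> \<le> 1" and "\<alpha> \<noteq> 0" and \<beta>: "0 \<le> \<beta>"
  shows "(S + 2 * w)\<^sup>2 \<le> (2 + 2 * \<chi>\<^sub>1 + 2 * \<chi>\<^sub>3) * N\<^sub>2 + (2 * \<chi>\<^sub>2 + 2 * \<mu> * \<chi>\<^sub>4) * N\<^sub>1 * \<Omega>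
    + (4 + 4 * (1 - \<mu>) * \<chi>\<^sub>4) * \<Omega>\<^sup>2"
proof -
  \<comment> \<open>In these terms \<open>\<beta> / (\<beta> + 1)\<close> is \<open>1 - t\<close>,
    and the bound uses \<open>\<alpha>\<close> only through \<open>c \<le> m + 1\<close>.\<close>
  define c m t where "c = cmod \<alpha>" and "m = max 1 (cmod (\<alpha> - 1))" and "t = 1 / (\<beta> + 1)"
  have c: "0 < c" "c \<le> m + 1"
    using \<open>\<alpha> \<noteq> 0\<close> norm_triangle_ineq[of "\<alpha> - 1" 1] by (auto simp: c_def m_def)
  have m: "1 \<le> m" "max 1 ((cmod (\<alpha> - 1))\<^sup>2) = m\<^sup>2"
    by (cases "cmod (\<alpha> - 1) \<le> 1";
        simp add: m_def power_le_one one_le_power max_absorb1 max_absorb2)+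
  have t: "0 \<le> t" "t \<le> 1"
    using \<beta> by (simp_all add: t_def)
  have \<chi>: "\<chi>\<^sub>1 = (1 - t + m\<^sup>2) / c\<^sup>2" "\<chi>\<^sub>2 = (t + 2 * m) / c\<^sup>2"
      "\<chi>\<^sub>3 = 2 * (1 - t + m\<^sup>2) / c\<^sup>2" "\<chi>\<^sub>4 = 2 * t / c\<^sup>2"
    using \<beta> c(1) unfolding \<chi>\<^sub>1_def \<chi>\<^sub>2_def \<chi>\<^sub>3_def \<chi>\<^sub>4_def m(2) t_def
    by (simp_all add: field_simps flip: c_def m_def)
  have \<chi>_nonneg: "0 \<le> \<chi>\<^sub>1" "0 \<le> \<chi>\<^sub>2" "0 \<le> \<chi>\<^sub>3" "0 \<le> \<chi>\<^sub>4"
    using t m(1) by (simp_all add: \<chi>)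
  have "4 * S * w \<le> (3 * (1 - t + m\<^sup>2) * S\<^sup>2 + 2 * (t + 2 * m) * (S * w) + 8 * t * w\<^sup>2) / c\<^sup>2"
    using quadratic_form_bound[OF w t(2) m(1) less_imp_le[OF c(1)] c(2)] c(1)
    by (simp add: pos_le_divide_eq)
  also have "\<dots> = (\<chi>\<^sub>1 + \<chi>\<^sub>3) * S\<^sup>2 + 2 * \<chi>\<^sub>2 * (S * w) + 4 * \<chi>\<^sub>4 * w\<^sup>2"
    by (simp add: \<chi> add_divide_distrib[symmetric] algebra_simps)
  finally have "(S + 2 * w)\<^sup>2 \<le> (1 + \<chi>\<^sub>1 + \<chi>\<^sub>3) * S\<^sup>2 + 2 * \<chi>\<^sub>2 * (S * w) + (4 + 4 * \<chi>\<^sub>4) * w\<^sup>2"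
    by (simp add: power2_eq_square algebra_simps)
  \<comment> \<open>The fraction \<open>\<mu>\<close> of the term
    \<open>4 * \<chi>\<^sub>4 * w^2\<close> is traded for a multiple of \<open>S * w\<close>, using
    \<open>2 * w \<le> S\<close>.\<close>
  also have "\<dots> \<le> (1 + \<chi>\<^sub>1 + \<chi>\<^sub>3) * S\<^sup>2 + (2 * \<chi>\<^sub>2 + 2 * \<mu> * \<chi>\<^sub>4) * (S * w)
      + (4 + 4 * (1 - \<mu>) * \<chi>\<^sub>4) * w\<^sup>2"
  proof -
    have "2 * w * w \<le> S * w"
      using w by (intro mult_right_mono)
    then have "2 * \<mu> * \<chi>\<^sub>4 * (2 * w * w) \<le> 2 * \<mu> * \<chi>\<^sub>4 * (S * w)"
      using \<mu> \<chi>_nonneg by (intro mult_left_mono) auto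
    then show ?thesis
      by (simp add: power2_eq_square algebra_simps)
  qed
  also have "\<dots> \<le> (1 + \<chi>\<^sub>1 + \<chi>\<^sub>3) * (2 * N\<^sub>2) + (2 * \<chi>\<^sub>2 + 2 * \<mu> * \<chi>\<^sub>4) * (N\<^sub>1 * \<Omega>)
      + (4 + 4 * (1 - \<mu>) * \<chi>\<^sub>4) * \<Omega>\<^sup>2"
    using w N \<mu> \<chi>_nonneg by (intro add_mono mult_mono power_mono) auto
  finally show ?thesis
    by (simp add: algebra_simps)
qed

theorem theorem2p44:
  fixes A F K X Y :: "'a::complex_hilbert_space \<Rightarrow> 'a"
    and \<mu> \<beta> :: real and \<alpha> :: complex
  defines "\<chi>\<^sub>1 \<equiv> (\<beta> + (\<beta> + 1) * max 1 ((cmod (\<alpha> - 1))\<^sup>2)) / ((cmod \<alpha>)\<^sup>2 * (\<beta> + 1))"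
    and "\<chi>\<^sub>2 \<equiv> (1 + 2 * (\<beta> + 1) * max 1 (cmod (\<alpha> - 1))) / ((cmod \<alpha>)\<^sup>2 * (\<beta> + 1))"
    and "\<chi>\<^sub>3 \<equiv> (2 * \<beta> + 2 * (\<beta> + 1) * max 1 ((cmod (\<alpha> - 1))\<^sup>2)) / ((cmod \<alpha>)\<^sup>2 * (\<beta> + 1))"
    and "\<chi>\<^sub>4 \<equiv> 2 / ((cmod \<alpha>)\<^sup>2 * (\<beta> + 1))"
  defines "AA \<equiv> op_block A zero_op zero_op A"
  assumes "positive_op A"
    and "F \<in> A_adjointable A" "K \<in> A_adjointable A"
    and "X \<in> A_adjointable A" "Y \<in> A_adjointable A"
    and "0 \<le> \<mu>" "\<mu> \<le> 1" and "\<alpha> \<noteq> 0" and "0 \<le> \<beta>"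
  shows "(A_numradius AA (op_block F X Y K)) ^ 4
    \<le> (2 + 2 * \<chi>\<^sub>1 + 2 * \<chi>\<^sub>3) *
        max (A_opnorm A ((A_sharp A F \<circ> F) ^^ 2 +\<^sub>o\<^sub>p (X \<circ> A_sharp A X) ^^ 2))
            (A_opnorm A ((A_sharp A K \<circ> K) ^^ 2 +\<^sub>o\<^sub>p (Y \<circ> A_sharp A Y) ^^ 2))
    + (2 * \<chi>\<^sub>2 + 2 * \<mu> * \<chi>\<^sub>4) *
        max (A_opnorm A ((A_sharp A F \<circ> F) +\<^sub>o\<^sub>p (X \<circ> A_sharp A X)))
            (A_opnorm A ((A_sharp A K \<circ> K) +\<^sub>o\<^sub>p (Y \<circ> A_sharp A Y))) *
        A_numradius AA (op_block zero_op (X \<circ> K) (Y \<circ> F) zero_op)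
    + (4 + 4 * (1 - \<mu>) * \<chi>\<^sub>4) *
        (A_numradius AA (op_block zero_op (X \<circ> K) (Y \<circ> F) zero_op))\<^sup>2"
proof -
  interpret A: positive_operator A by standard fact
  interpret AA: positive_operator AA
    unfolding AA_def by standard (rule positive_op_diag, fact)
  note adj = \<open>F \<in> A_adjointable A\<close> \<open>K \<in> A_adjointable A\<close> \<open>X \<in> A_adjointable A\<close> \<open>Y \<in> A_adjointable A\<close>
  have ip_AA: "A_inner AA (u, v) (u', v') = A_inner A u u' + A_inner A v v'" for u v u' v'
    by (simp add: A_inner_def AA_def op_block_def cinner_prod_def)
  have norm_AA: "(A_norm AA (u, v))\<^sup>2 = (A_norm A u)\<^sup>2 + (A_norm A v)\<^sup>2" for u v
    unfolding A.Re_ip_self[symmetric] AA.Re_ip_self[symmetric] ip_AA by simp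
  have bcl: "bounded_clinear T" if "T \<in> A_adjointable A" for T
    using that by (simp add: A_adjointable_def)
  define M where "M = op_block F X Y K"
  define W where "W = op_block zero_op (X \<circ> K) (Y \<circ> F) zero_op"
  define P where "P G Z = (A_sharp A G \<circ> G) +\<^sub>o\<^sub>p (Z \<circ> A_sharp A Z)" for G Z :: "'a \<Rightarrow> 'a"
  define Q where "Q G Z = (A_sharp A G \<circ> G) ^^ 2 +\<^sub>o\<^sub>p (Z \<circ> A_sharp A Z) ^^ 2" for G Z :: "'a \<Rightarrow> 'a"
  define N\<^sub>1 where "N\<^sub>1 = max (A_opnorm A (P F X)) (A_opnorm A (P K Y))"
  define N\<^sub>2 where "N\<^sub>2 = max (A_opnorm A (Q F X)) (A_opnorm A (Q K Y))"

  have sharp: "A_inner A (A_sharp A T x) y = A_inner A x (T y)"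
    "A_inner A x (A_sharp A T y) = A_inner A (T x) y" if "T \<in> A_adjointable A" for T x y
    using A.A_sharp_ip[OF that] A.ip_A_sharp[OF that] by simp_all
  \<comment> \<open>Equal right-hand sides give the symmetry that the bounds by
    \<open>A_opnorm\<close> require; at \<open>y = x\<close> they are sums of squared
    seminorms.\<close>
  have P_ip: "A_inner A (P G Z x) y = A_inner A (G x) (G y) + A_inner A (A_sharp A Z x) (A_sharp A Z y)"
    "A_inner A x (P G Z y) = A_inner A (G x) (G y) + A_inner A (A_sharp A Z x) (A_sharp A Z y)"
    if "G \<in> A_adjointable A" "Z \<in> A_adjointable A" for G Z x y
    by (simp_all add: P_def A.ip_add_left A.ip_add_right sharp(2)[OF that(1)] sharp(2)[OF that(2)]
        sharp(1)[OF that(1), symmetric] sharp(1)[OF that(2), symmetric])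
  \<comment> \<open>One factor of each square is moved to the other side.\<close>
  have Q_ip: "A_inner A (Q G Z x) y = A_inner A (A_sharp A G (G x)) (A_sharp A G (G y))
        + A_inner A (Z (A_sharp A Z x)) (Z (A_sharp A Z y))"
    "A_inner A x (Q G Z y) = A_inner A (A_sharp A G (G x)) (A_sharp A G (G y))
        + A_inner A (Z (A_sharp A Z x)) (Z (A_sharp A Z y))"
    if "G \<in> A_adjointable A" "Z \<in> A_adjointable A" for G Z x y
    by (simp_all add: Q_def A.ip_add_left A.ip_add_right sharp(2)[OF that(1)] sharp(2)[OF that(2)]
        sharp(1)[OF that(1), symmetric] sharp(1)[OF that(2), symmetric] numeral_2_eq_2)
  have P_bcl: "bounded_clinear (P G Z)" and Q_bcl: "bounded_clinear (Q G Z)"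
    if "G \<in> A_adjointable A" "Z \<in> A_adjointable A" for G Z
    unfolding P_def Q_def numeral_2_eq_2 funpow.simps comp_id
    by (intro bounded_clinear_add bounded_clinear_compose bcl A.bounded_clinear_A_sharp that)+
  have P_le: "Re (A_inner A (P G Z x) x) \<le> A_opnorm A (P G Z) * (A_norm A x)\<^sup>2"
    and P_nonneg: "0 \<le> A_opnorm A (P G Z)"
    and Q_le: "Re (A_inner A (Q G Z x) x) \<le> A_opnorm A (Q G Z) * (A_norm A x)\<^sup>2"
    and Q_nonneg: "0 \<le> A_opnorm A (Q G Z)"
    if "G \<in> A_adjointable A" "Z \<in> A_adjointable A" for G Z x
    by (rule A.ip_le_A_opnorm A.A_opnorm_nonneg; simp add: P_bcl Q_bcl P_ip Q_ip that)+

  have N_nonneg: "0 \<le> N\<^sub>1" "0 \<le> N\<^sub>2"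
    unfolding N\<^sub>1_def N\<^sub>2_def using P_nonneg Q_nonneg adj by (simp_all add: le_max_iff_disj)

  \<comment> \<open>For \<open>z = (u, v)\<close>, \<open>a z\<close> is the diagonal part applied
    to \<open>z\<close>. The adjoint of the off-diagonal part swaps the positions of
    \<open>X\<close> and \<open>Y\<close>, which gives \<open>b z\<close>.\<close>
  define a where "a z = (F (fst z), K (snd z))" for z :: "'a \<times> 'a"
  define b where "b z = (A_sharp A Y (snd z), A_sharp A X (fst z))" for z :: "'a \<times> 'a"
  define S where "S z = (A_norm AA (a z))\<^sup>2 + (A_norm AA (b z))\<^sup>2" for z
  have M_ip: "A_inner AA (M z) z = A_inner AA (a z) z + A_inner AA z (b z)" for z
    by (cases z) (simp add: M_def op_block_def a_def b_def ip_AA A.ip_add_left sharp(2) adj)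
  have W_ip: "A_inner AA (W z) z = A_inner AA (a z) (b z)" for z
    by (cases z) (simp add: W_def op_block_def a_def b_def ip_AA sharp(2) adj)

  have W_le_S: "2 * cmod (A_inner AA (W z) z) \<le> S z" for z
    using AA.ip_cauchy_schwarz[of "a z" "b z"]
      sum_squares_bound[of "A_norm AA (a z)" "A_norm AA (b z)"]
    by (simp add: W_ip S_def)
  have unit: "(A_norm A u)\<^sup>2 + (A_norm A v)\<^sup>2 = 1" if "A_norm AA (u, v) = 1" for u v
    using norm_AA[of u v] that by simp
  have S_le: "S z \<le> N\<^sub>1" if z: "A_norm AA z = 1" for z
  proof (cases z)
    case (Pair u v)
    \<comment> \<open>Regrouping the four squared seminorms by the components \<open>u\<close> and
      \<open>v\<close> pairs \<open>F\<close> with \<open>X\<close> and \<open>K\<close> with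
      \<open>Y\<close>.\<close>
    have "S z = Re (A_inner A (P F X u) u) + Re (A_inner A (P K Y v) v)"
      by (simp add: Pair S_def a_def b_def norm_AA P_ip adj A.Re_ip_self)
    also have "\<dots> \<le> A_opnorm A (P F X) * (A_norm A u)\<^sup>2 + A_opnorm A (P K Y) * (A_norm A v)\<^sup>2"
      by (intro add_mono P_le adj)
    also have "\<dots> \<le> N\<^sub>1 * (A_norm A u)\<^sup>2 + N\<^sub>1 * (A_norm A v)\<^sup>2"
      by (intro add_mono mult_right_mono) (auto simp: N\<^sub>1_def)
    finally show ?thesis
      using unit[of u v] z by (simp add: Pair flip: distrib_left)
  qed
  have S_sq_le: "(S z)\<^sup>2 \<le> 2 * N\<^sub>2" if z: "A_norm AA z = 1" for z
  proof (cases z)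
    case (Pair u v)
    \<comment> \<open>With \<open>D\<close> and \<open>O\<close> the diagonal and off-diagonal
      parts, \<open>x\<close> is \<open>D\<close> followed by its adjoint, and \<open>y\<close> is
      the adjoint of \<open>O\<close> followed by \<open>O\<close>. Thus \<open>S z\<close> is
      linear in \<open>x + y\<close>, while the squared seminorms of \<open>x\<close> and
      \<open>y\<close> add up to the quadratic forms of \<open>Q\<close>.\<close>
    define x where "x = (A_sharp A F (F u), A_sharp A K (K v))"
    define y where "y = (X (A_sharp A X u), Y (A_sharp A Y v))"
    have "complex_of_real ((A_norm AA (a z))\<^sup>2) = A_inner AA x z"
      by (simp only: AA.ip_self[symmetric]) (simp add: Pair a_def x_def ip_AA sharp adj)
    moreover have "complex_of_real ((A_norm AA (b z))\<^sup>2) = A_inner AA y z"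
      by (simp only: AA.ip_self[symmetric]) (simp add: Pair b_def y_def ip_AA sharp(2) adj)
    ultimately have S: "S z = Re (A_inner AA x z) + Re (A_inner AA y z)"
      unfolding S_def by (metis Re_complex_of_real)
    have "S z \<le> A_norm AA x + A_norm AA y"
      using AA.ip_cauchy_schwarz_Re[of x z] AA.ip_cauchy_schwarz_Re[of y z] by (simp add: S z)
    then have "(S z)\<^sup>2 \<le> (A_norm AA x + A_norm AA y)\<^sup>2"
      by (rule power_mono) (simp add: S_def)
    also have "\<dots> \<le> 2 * ((A_norm AA x)\<^sup>2 + (A_norm AA y)\<^sup>2)"
      using sum_squares_bound[of "A_norm AA x" "A_norm AA y"] by (simp add: power2_sum)
    also have "(A_norm AA x)\<^sup>2 + (A_norm AA y)\<^sup>2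
        = Re (A_inner A (Q F X u) u) + Re (A_inner A (Q K Y v) v)"
      by (simp add: x_def y_def norm_AA Q_ip adj A.Re_ip_self)
    also have "\<dots> \<le> A_opnorm A (Q F X) * (A_norm A u)\<^sup>2 + A_opnorm A (Q K Y) * (A_norm A v)\<^sup>2"
      by (intro add_mono Q_le adj)
    also have "\<dots> \<le> N\<^sub>2 * (A_norm A u)\<^sup>2 + N\<^sub>2 * (A_norm A v)\<^sup>2"
      by (intro add_mono mult_right_mono) (auto simp: N\<^sub>2_def)
    finally show ?thesis
      using unit[of u v] z by (simp add: Pair flip: distrib_left)
  qed

  define \<Omega> where "\<Omega> = A_numradius AA W"
  \<comment> \<open>Boundedness of the numerical radius of \<open>W\<close> comes from
    \<open>2 * w \<le> S\<close> and \<open>S \<le> N\<^sub>1\<close> on unit vectors.\<close>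
  have bdd: "bdd_above (insert 0 {cmod (A_inner AA (W z) z) | z. A_norm AA z = 1})"
  proof (rule bdd_aboveI)
    have "cmod (A_inner AA (W z) z) \<le> N\<^sub>1" if "A_norm AA z = 1" for z
      using W_le_S[of z] S_le[OF that] norm_ge_zero[of "A_inner AA (W z) z"] by linarith
    then show "c \<le> N\<^sub>1" if "c \<in> insert 0 {cmod (A_inner AA (W z) z) | z. A_norm AA z = 1}" for c
      using that N_nonneg(1) by auto
  qed
  have \<Omega>: "0 \<le> \<Omega>"
    unfolding \<Omega>_def A_numradius_def by (rule cSup_upper[OF _ bdd]) simp
  have W_le: "cmod (A_inner AA (W z) z) \<le> \<Omega>" if "A_norm AA z = 1" for z
    unfolding \<Omega>_def A_numradius_def by (rule cSup_upper[OF _ bdd]) (use that in blast)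

  define R where "R = (2 + 2 * \<chi>\<^sub>1 + 2 * \<chi>\<^sub>3) * N\<^sub>2 + (2 * \<chi>\<^sub>2 + 2 * \<mu> * \<chi>\<^sub>4) * N\<^sub>1 * \<Omega>
    + (4 + 4 * (1 - \<mu>) * \<chi>\<^sub>4) * \<Omega>\<^sup>2"
  have bound: "(s + 2 * w)\<^sup>2 \<le> R"
    if "0 \<le> w" "2 * w \<le> s" "s \<le> N\<^sub>1" "s\<^sup>2 \<le> 2 * N\<^sub>2" "w \<le> \<Omega>" for s w
    unfolding R_def \<chi>\<^sub>1_def \<chi>\<^sub>2_def \<chi>\<^sub>3_def \<chi>\<^sub>4_def
    using that \<open>0 \<le> \<mu>\<close> \<open>\<mu> \<le> 1\<close> \<open>\<alpha> \<noteq> 0\<close> \<open>0 \<le> \<beta>\<close> by (rule fourth_power_bound)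
  \<comment> \<open>The set defining the numerical radius contains the inserted 0, so
    \<open>root 4 R\<close> must also bound 0; without unit vectors no other estimate would give
    this.\<close>
  have R_nonneg: "0 \<le> R"
    using bound[of 0 0] N_nonneg \<Omega> by simp
  have M_le: "cmod (A_inner AA (M z) z) \<le> root 4 R" if z: "A_norm AA z = 1" for z
  proof -
    have "(cmod (A_inner AA (M z) z))\<^sup>2 \<le> S z + 2 * cmod (A_inner AA (W z) z)"
      unfolding M_ip W_ip S_def by (rule AA.cmod_ip_sum_sq_le[OF z])
    then have "((cmod (A_inner AA (M z) z))\<^sup>2)\<^sup>2 \<le> (S z + 2 * cmod (A_inner AA (W z) z))\<^sup>2"
      by (rule power_mono) simp
    also have "\<dots> \<le> R"
      using W_le_S[of z] S_le[OF z] S_sq_le[OF z] W_le[OF z] by (intro bound) auto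
    finally have "cmod (A_inner AA (M z) z) ^ 4 \<le> R"
      by (simp flip: power_mult)
    then have "root 4 (cmod (A_inner AA (M z) z) ^ 4) \<le> root 4 R"
      by simp
    then show ?thesis by (simp add: real_root_power_cancel)
  qed
  have "0 \<le> A_numradius AA M"
    unfolding A_numradius_def
    by (rule cSup_upper) (use M_le R_nonneg in \<open>auto intro!: bdd_aboveI[of _ "root 4 R"]\<close>)
  moreover have "A_numradius AA M \<le> root 4 R"
    unfolding A_numradius_def by (rule cSup_least) (use M_le R_nonneg in auto)
  ultimately have "A_numradius AA M ^ 4 \<le> root 4 R ^ 4"
    by (intro power_mono)
  then show ?thesis
    using R_nonneg by (simp add: R_def M_def W_def N\<^sub>1_def N\<^sub>2_def P_def Q_def \<Omega>_def)
qed

end
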